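(* Let $n,d\in\mathbb{N}$ and let $D=(V,A)$ be a finite antisymmetric digraph. Then $D\in\mathcal{H}(P_n^d)$ if and only if $\Delta(U)\leq n-1$ for every undirected walk $U$ in $D$. In this case, the map $l:V\to\{0,\dots,n-1\}$ defined by $$l(v)=\max\{\Delta(U): U \text{ an undirected walk in } D \text{ with last vertex } v\}$$ is a homomorphism from $D$ to $P_n^d$, and it can be computed in time $O(|V|\cdot|A|)$.
   Context: $P_n^d$ is the digraph on vertex set $\{0,\dots,n-1\}$ with an arc $ij$ if and only if $j-i\in\{1,\dots,d\}$. For a digraph $H$, $\mathcal{H}(H)$ is the class of digraphs admitting a homomorphism to $H$ (a map $l$ on vertices with $l(u)l(v)$ an arc of $H$ whenever $uv$ is an arc). A digraph is antisymmetric if it never contains both arcs $uv$ and $vu$. An undirected walk in an antisymmetric digraph $D=(V,A)$ is a sequence $U=(u_0,u_1,\dots,u_m)$ of vertices ($m\geq 0$) such that for each $i\in\{1,\dots,m\}$ either $u_{i-1}u_i\in A$ (a forward arc) or $u_iu_{i-1}\in A$ (a backward arc). If $m^+$ and $m^-=m-m^+$ are the numbers of forward and backward arcs of $U$, then $\Delta(U):=m^+-d\,m^-$ (depending on $d$). *)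

theory Defs
  imports Main "Graph_Theory.Pair_Digraph"
begin

subsection \<open>Digraphs, homomorphisms and undirected walks\<close>

text \<open>
  Taking \<open>u = v\<close> in the definition of antisymmetry shows that loops are excluded; this is what
  the library's \<open>asym\<close> says (its \<open>antisym\<close> would allow loops).
\<close>

definition antisymmetric_digraph :: "'a pair_pre_digraph \<Rightarrow> bool" where
  "antisymmetric_digraph D \<longleftrightarrow> asym (parcs D)"

definition digraph_hom ::
  "'a pair_pre_digraph \<Rightarrow> 'b pair_pre_digraph \<Rightarrow> ('a \<Rightarrow> 'b) \<Rightarrow> bool" where
  "digraph_hom D H l \<longleftrightarrow>
     (\<forall>v \<in> pverts D. l v \<in> pverts H) \<and> (\<forall>(u, v) \<in> parcs D. (l u, l v) \<in> parcs H)"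

definition hom_class :: "'b pair_pre_digraph \<Rightarrow> 'a pair_pre_digraph set" where
  "hom_class H = {D. \<exists>l. digraph_hom D H l}"

text \<open>The vertices of \<open>P\<^sub>n\<^sup>d\<close> are integers, so that the difference \<open>j - i\<close> is not truncated.\<close>

definition path_power :: "nat \<Rightarrow> nat \<Rightarrow> int pair_pre_digraph" where
  "path_power n d =
     \<lparr> pverts = {0..<int n},
       parcs = {(i, j). i \<in> {0..<int n} \<and> j \<in> {0..<int n} \<and> j - i \<in> {1..int d}} \<rparr>"

text \<open>A walk \<open>(u\<^sub>0, \<dots>, u\<^sub>m)\<close> is the list of its \<open>m + 1\<close> vertices.\<close>

definition undirected_walk :: "'a pair_pre_digraph \<Rightarrow> 'a list \<Rightarrow> bool" where
  "undirected_walk D U \<longleftrightarrow>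
     U \<noteq> [] \<and> set U \<subseteq> pverts D \<and>
     (\<forall>i \<in> {1..length U - 1}.
        (U ! (i - 1), U ! i) \<in> parcs D \<or> (U ! i, U ! (i - 1)) \<in> parcs D)"

definition forward_arcs :: "'a pair_pre_digraph \<Rightarrow> 'a list \<Rightarrow> nat" where
  "forward_arcs D U = card {i \<in> {1..length U - 1}. (U ! (i - 1), U ! i) \<in> parcs D}"

definition backward_arcs :: "'a pair_pre_digraph \<Rightarrow> 'a list \<Rightarrow> nat" where
  "backward_arcs D U = card {i \<in> {1..length U - 1}. (U ! i, U ! (i - 1)) \<in> parcs D}"

definition walk_weight :: "'a pair_pre_digraph \<Rightarrow> nat \<Rightarrow> 'a list \<Rightarrow> int" where
  "walk_weight D d U = int (forward_arcs D U) - int d * int (backward_arcs D U)"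

text \<open>
  \<open>Max\<close> would be wrong here: the set of weights is in general not bounded below, hence infinite.
\<close>

definition walk_weights_to :: "'a pair_pre_digraph \<Rightarrow> nat \<Rightarrow> 'a \<Rightarrow> int set" where
  "walk_weights_to D d v = {walk_weight D d U |U. undirected_walk D U \<and> last U = v}"

definition max_walk_weight :: "'a pair_pre_digraph \<Rightarrow> nat \<Rightarrow> 'a \<Rightarrow> int" where
  "max_walk_weight D d v = (GREATEST k. k \<in> walk_weights_to D d v)"


subsection \<open>Running time: the random access machine with uniform cost\<close>

text \<open>
  A program is a finite list of instructions, so it uses only finitely many registers; the memory
  is unbounded and is accessed indirectly through registers. Registers and memory cells hold natural
  numbers. Every instruction costs one time unit. As usual for the uniform cost measure, there is
  no multiplication, so that a number grows by at most one bit per step. \<open>Sub\<close> is truncated.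
\<close>

datatype instr =
    Const nat nat           \<comment> \<open>\<open>Const r c\<close>: \<open>R[r] := c\<close>\<close>
  | Add nat nat nat         \<comment> \<open>\<open>Add r s t\<close>: \<open>R[r] := R[s] + R[t]\<close>\<close>
  | Sub nat nat nat         \<comment> \<open>\<open>Sub r s t\<close>: \<open>R[r] := R[s] - R[t]\<close>\<close>
  | Load nat nat            \<comment> \<open>\<open>Load r s\<close>: \<open>R[r] := M[R[s]]\<close>\<close>
  | Store nat nat           \<comment> \<open>\<open>Store r s\<close>: \<open>M[R[r]] := R[s]\<close>\<close>
  | Jump_less nat nat nat   \<comment> \<open>\<open>Jump_less r s k\<close>: if \<open>R[r] < R[s]\<close> then go to instruction \<open>k\<close>\<close>

text \<open>A configuration consists of the program counter, the registers and the memory.\<close>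

type_synonym config = "nat \<times> (nat \<Rightarrow> nat) \<times> (nat \<Rightarrow> nat)"

fun exec_instr :: "instr \<Rightarrow> config \<Rightarrow> config" where
  "exec_instr (Const r c) (pc, R, M) = (Suc pc, R(r := c), M)"
| "exec_instr (Add r s t) (pc, R, M) = (Suc pc, R(r := R s + R t), M)"
| "exec_instr (Sub r s t) (pc, R, M) = (Suc pc, R(r := R s - R t), M)"
| "exec_instr (Load r s) (pc, R, M) = (Suc pc, R(r := M (R s)), M)"
| "exec_instr (Store r s) (pc, R, M) = (Suc pc, R, M(R r := R s))"
| "exec_instr (Jump_less r s k) (pc, R, M) = ((if R r < R s then k else Suc pc), R, M)"

text \<open>The machine has halted once the program counter has left the program.\<close>

definition ram_step :: "instr list \<Rightarrow> config \<Rightarrow> config" where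
  "ram_step p c = (if fst c < length p then exec_instr (p ! fst c) c else c)"

text \<open>
  Started at instruction \<open>0\<close> with all registers \<open>0\<close> and memory \<open>M\<close>, the program \<open>p\<close> halts after at
  most \<open>t\<close> steps, with final memory \<open>M'\<close>.
\<close>

definition ram_halts_within ::
  "instr list \<Rightarrow> (nat \<Rightarrow> nat) \<Rightarrow> nat \<Rightarrow> (nat \<Rightarrow> nat) \<Rightarrow> bool" where
  "ram_halts_within p M t M' \<longleftrightarrow>
     (\<exists>pc R. (ram_step p ^^ t) (0, (\<lambda>_. 0), M) = (pc, R, M') \<and> length p \<le> pc)"

text \<open>
  A digraph is presented by a numbering \<open>\<phi>\<close> of its vertices and a list of its arcs without
  repetitions. The input consists of \<open>|V|\<close>, \<open>|A|\<close>, \<open>d\<close> and the numbers of the two ends of every arc,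
  in consecutive memory cells; all other cells are \<open>0\<close>. The output, the value at every vertex
  in the order of the numbering, is to be found in the \<open>|V|\<close> cells following the input.
\<close>

definition presents ::
  "('a \<Rightarrow> nat) \<Rightarrow> ('a \<times> 'a) list \<Rightarrow> 'a pair_pre_digraph \<Rightarrow> bool" where
  "presents \<phi> as D \<longleftrightarrow>
     bij_betw \<phi> (pverts D) {..<card (pverts D)} \<and> distinct as \<and> set as = parcs D"

definition ram_input ::
  "('a \<Rightarrow> nat) \<Rightarrow> ('a \<times> 'a) list \<Rightarrow> 'a pair_pre_digraph \<Rightarrow> nat \<Rightarrow> nat list" where
  "ram_input \<phi> as D d =
     [card (pverts D), card (parcs D), d] @ concat (map (\<lambda>(u, v). [\<phi> u, \<phi> v]) as)"

definition memory_of :: "nat list \<Rightarrow> nat \<Rightarrow> nat" where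
  "memory_of xs a = (if a < length xs then xs ! a else 0)"

definition ram_computes_within ::
  "instr list \<Rightarrow> 'a pair_pre_digraph \<Rightarrow> nat \<Rightarrow> ('a \<Rightarrow> int) \<Rightarrow> nat \<Rightarrow> bool" where
  "ram_computes_within p D d l t \<longleftrightarrow>
     (\<forall>\<phi> as. presents \<phi> as D \<longrightarrow>
        (\<exists>M'. ram_halts_within p (memory_of (ram_input \<phi> as D d)) t M' \<and>
              (\<forall>v \<in> pverts D. int (M' (length (ram_input \<phi> as D d) + \<phi> v)) = l v)))"

end

(* A walk gains at most the difference of the images of its ends under a homomorphism to the path
   power, so weights are bounded by n - 1; conversely, extending an optimal walk by one arc shows
   that the maximum weight l satisfies 1 <= l v - l u <= d on every arc (u, v). Closed walks then
   have weight at most 0, so simple walks are optimal, and the maximum weights are found by the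
   Bellman-Ford method: |V| rounds of relaxing every arc in both directions, started from 0. *)

theory Submission
  imports Defs
begin

section \<open>Walks and their weights\<close>

text \<open>The counts in \<open>walk_weight\<close> run over index sets, which is awkward for
  cutting walks; this recursion over consecutive pairs replaces them and agrees with
  \<open>walk_weight\<close> on walks by \<open>walk_weight_eq_step_sum\<close>.\<close>

fun step_sum :: "('a \<Rightarrow> 'a \<Rightarrow> int) \<Rightarrow> 'a list \<Rightarrow> int" where
  "step_sum c (x # y # zs) = c x y + step_sum c (y # zs)"
| "step_sum c _ = 0"

text \<open>The vertex \<open>w\<close> is kept in both pieces, so that every consecutive pair falls
  into exactly one of them.\<close>

lemma step_sum_append:
  "step_sum c (xs @ w # ys) = step_sum c (xs @ [w]) + step_sum c (w # ys)"
  by (induction c xs rule: step_sum.induct) (auto split: list.splits)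

lemma step_sum_snoc: "xs \<noteq> [] \<Longrightarrow> step_sum c (xs @ [v]) = step_sum c xs + c (last xs) v"
  by (cases xs rule: rev_cases) (simp_all add: step_sum_append[of c _ _ "[v]"])

text \<open>Index 1 belongs to the leading pair, and the remaining indices are those of the tail
  shifted by \<open>Suc\<close>. With \<open>P\<close> as arc or as reversed arc it gives the
  recursion of both counts.\<close>

lemma card_consecutive_Cons:
  "card {i \<in> {1..length (x # y # zs) - 1}. P ((x # y # zs) ! (i - 1)) ((x # y # zs) ! i)} =
     (if P x y then 1 else 0) +
     card {i \<in> {1..length (y # zs) - 1}. P ((y # zs) ! (i - 1)) ((y # zs) ! i)}"
  (is "card ?A = _ + card ?B")
proof -
  have "?A = (if P x y then {1} else {}) \<union> Suc ` ?B"
  proof (intro set_eqI)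
    fix i
    show "i \<in> ?A \<longleftrightarrow> i \<in> (if P x y then {1} else {}) \<union> Suc ` ?B"
    proof (cases i)
      case (Suc j)
      then show ?thesis by (cases j) (auto simp: image_iff)
    qed (auto simp: image_iff)
  qed
  moreover have "(if P x y then {1} else {}) \<inter> Suc ` ?B = {}" by auto
  moreover have "finite ?B" by simp
  moreover have "card (Suc ` ?B) = card ?B" by (simp add: card_image)
  ultimately show ?thesis by (simp add: card_Un_disjoint del: One_nat_def)
qed

lemma undirected_walk_iff_successively:
  "undirected_walk D U \<longleftrightarrow> U \<noteq> [] \<and> set U \<subseteq> pverts D \<and>
     successively (\<lambda>u v. (u, v) \<in> parcs D \<or> (v, u) \<in> parcs D) U"
proof -
  \<comment> \<open>An index shift by one; for \<open>k = 0\<close> the subtraction is truncated,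
    but both ranges are empty.\<close>
  have "(\<forall>i \<in> {1..k - 1}. P (i - 1) i) \<longleftrightarrow> (\<forall>i. Suc i < k \<longrightarrow> P i (Suc i))" for k and P :: "nat \<Rightarrow> nat \<Rightarrow> bool"
  proof (intro iffI allI ballI impI)
    fix i assume *: "\<forall>i. Suc i < k \<longrightarrow> P i (Suc i)" and "i \<in> {1..k - 1}"
    then show "P (i - 1) i" using *[rule_format, of "i - 1"] by auto
  qed (drule_tac x = "Suc i" in bspec; auto)
  from this[of "length U" "\<lambda>i j. (U ! i, U ! j) \<in> parcs D \<or> (U ! j, U ! i) \<in> parcs D"]
  show ?thesis
    unfolding undirected_walk_def successively_conv_nth by (simp del: One_nat_def)
qed

lemma undirected_walk_append_iff:
  "undirected_walk D (xs @ w # ys) \<longleftrightarrow> undirected_walk D (xs @ [w]) \<and> undirected_walk D (w # ys)"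
  by (auto simp: undirected_walk_iff_successively successively_append_iff)

lemma max_walk_weight_eqI:
  assumes "k \<in> walk_weights_to D d v" "\<And>j. j \<in> walk_weights_to D d v \<Longrightarrow> j \<le> k"
  shows "max_walk_weight D d v = k"
  unfolding max_walk_weight_def using assms by (intro Greatest_equality)

locale antisymmetric_pair_digraph = pair_fin_digraph D
  for D :: "'a pair_pre_digraph" +
  fixes d :: nat
  assumes antisymmetric: "antisymmetric_digraph D"
begin

section \<open>Walk weights in an antisymmetric digraph\<close>

lemma not_both_arcs: "(u, v) \<in> parcs D \<Longrightarrow> (v, u) \<notin> parcs D"
  using antisymmetric by (auto simp: antisymmetric_digraph_def dest: asymD)

lemma arc_ends:
  assumes "(u, v) \<in> parcs D" shows "u \<in> pverts D" "v \<in> pverts D" "u \<noteq> v"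
  using assms in_arcsD1 in_arcsD2 not_both_arcs[OF assms] by auto

text \<open>By antisymmetry, testing for the forward arc decides the direction of a step. The value
  at non-adjacent pairs is a dummy, since only steps of walks are evaluated.\<close>

definition arc_weight :: "'a \<Rightarrow> 'a \<Rightarrow> int" where
  "arc_weight u v = (if (u, v) \<in> parcs D then 1 else - int d)"

lemma walk_weight_eq_step_sum:
  "undirected_walk D U \<Longrightarrow> walk_weight D d U = step_sum arc_weight U"
proof (induction arc_weight U rule: step_sum.induct)
  case (1 x y zs)
  from 1(2) have w: "undirected_walk D (y # zs)"
    and xy: "(x, y) \<in> parcs D \<or> (y, x) \<in> parcs D"
    by (auto simp: undirected_walk_iff_successively)
  have "walk_weight D d (x # y # zs) = arc_weight x y + walk_weight D d (y # zs)"
    unfolding walk_weight_def forward_arcs_def backward_arcs_def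
      card_consecutive_Cons[where P = "\<lambda>a b. (a, b) \<in> parcs D"]
      card_consecutive_Cons[where P = "\<lambda>a b. (b, a) \<in> parcs D"]
    using xy not_both_arcs[of x y] by (auto simp: arc_weight_def algebra_simps)
  with 1(1)[OF w] show ?case by simp
qed (simp_all add: walk_weight_def forward_arcs_def backward_arcs_def)

lemma undirected_walk_singleton: "v \<in> pverts D \<Longrightarrow> undirected_walk D [v]"
  by (simp add: undirected_walk_iff_successively)

text \<open>Witnessed by the walk \<open>[v]\<close>; this makes the weight sets nonempty and their
  maxima nonnegative.\<close>

lemma zero_in_walk_weights_to: "v \<in> pverts D \<Longrightarrow> 0 \<in> walk_weights_to D d v"
  using undirected_walk_singleton[of v] walk_weight_eq_step_sum[of "[v]"]
  unfolding walk_weights_to_def by force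

lemma undirected_walk_snoc:
  assumes "undirected_walk D U" "(last U, v) \<in> parcs D \<or> (v, last U) \<in> parcs D"
  shows "undirected_walk D (U @ [v])"
    "walk_weight D d (U @ [v]) = walk_weight D d U + arc_weight (last U) v"
proof -
  show w: "undirected_walk D (U @ [v])"
    using assms arc_ends(1,2)
    by (auto simp: undirected_walk_iff_successively successively_append_iff)
  show "walk_weight D d (U @ [v]) = walk_weight D d U + arc_weight (last U) v"
    using assms(1) w
    by (simp add: walk_weight_eq_step_sum step_sum_snoc undirected_walk_def)
qed

lemma walk_weights_to_extend:
  assumes "k \<in> walk_weights_to D d u"
  shows "(u, v) \<in> parcs D \<Longrightarrow> k + 1 \<in> walk_weights_to D d v"
    and "(v, u) \<in> parcs D \<Longrightarrow> k - int d \<in> walk_weights_to D d v"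
proof -
  from assms obtain U where U: "undirected_walk D U" "last U = u" "walk_weight D d U = k"
    by (auto simp: walk_weights_to_def)
  show "k + 1 \<in> walk_weights_to D d v" if "(u, v) \<in> parcs D"
    using undirected_walk_snoc[of U v] U that
    by (auto simp: walk_weights_to_def arc_weight_def intro!: exI[of _ "U @ [v]"])
  show "k - int d \<in> walk_weights_to D d v" if "(v, u) \<in> parcs D"
    using undirected_walk_snoc[of U v] U that not_both_arcs[OF that]
    by (auto simp: walk_weights_to_def arc_weight_def intro!: exI[of _ "U @ [v]"])
qed

section \<open>Potentials, homomorphisms and maximum weights\<close>

definition potential :: "('a \<Rightarrow> int) \<Rightarrow> bool" where
  "potential h \<longleftrightarrow> (\<forall>(u, v) \<in> parcs D. h u + 1 \<le> h v \<and> h v \<le> h u + int d)"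

text \<open>A potential obeys the arc condition of a homomorphism to a path power, without a bound
  on the range. Hence a step from \<open>x\<close> to \<open>y\<close> weighs at most
  \<open>h y - h x\<close> in either direction, and the sum telescopes.\<close>

lemma potential_walk_weight:
  assumes "potential h" "undirected_walk D U"
  shows "walk_weight D d U \<le> h (last U) - h (hd U)"
proof -
  have "step_sum arc_weight U \<le> h (last U) - h (hd U)" using assms
  proof (induction arc_weight U rule: step_sum.induct)
    case (1 x y zs)
    then have "arc_weight x y \<le> h y - h x"
      by (auto simp: undirected_walk_iff_successively potential_def arc_weight_def)
    moreover have "step_sum arc_weight (y # zs) \<le> h (last (y # zs)) - h (hd (y # zs))"
      using 1 by (auto simp: undirected_walk_iff_successively)
    ultimately show ?case by simp
  qed (auto simp: undirected_walk_def)
  with assms(2) show ?thesis by (simp add: walk_weight_eq_step_sum)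
qed

lemma digraph_hom_path_power_iff:
  "digraph_hom D (path_power n d) h \<longleftrightarrow> potential h \<and> (\<forall>v \<in> pverts D. 0 \<le> h v \<and> h v < int n)"
  using arc_ends unfolding digraph_hom_def path_power_def potential_def by fastforce

text \<open>\<open>GREATEST\<close> is meaningful only once a greatest element is known to exist.
  The weights may be unbounded below, but since 0 is among them, their part in \<open>{0..b}\<close>
  is finite, nonempty and has the same maximum.\<close>

lemma max_walk_weight_greatest:
  assumes bound: "\<And>U. undirected_walk D U \<Longrightarrow> walk_weight D d U \<le> b" and v: "v \<in> pverts D"
  shows "max_walk_weight D d v \<in> walk_weights_to D d v"
    and "k \<in> walk_weights_to D d v \<Longrightarrow> k \<le> max_walk_weight D d v"
proof -
  let ?S = "walk_weights_to D d v"
  let ?T = "?S \<inter> {0..b}"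
  have b: "k \<le> b" if "k \<in> ?S" for k
    using that bound by (auto simp: walk_weights_to_def)
  have fin: "finite ?T" by simp
  have zero: "0 \<in> ?T" using zero_in_walk_weights_to[OF v] b by auto
  have Max_in: "Max ?T \<in> ?T" using Max_in[OF fin] zero by blast
  have Max_ge: "k \<le> Max ?T" if "k \<in> ?S" for k
  proof (cases "0 \<le> k")
    case True
    then show ?thesis using that b by (intro Max_ge[OF fin]) auto
  next
    case False
    then show ?thesis using Max_in by auto
  qed
  have eq: "max_walk_weight D d v = Max ?T"
    using Max_in Max_ge by (intro max_walk_weight_eqI) auto
  show "max_walk_weight D d v \<in> ?S" using eq Max_in by simp
  show "k \<le> max_walk_weight D d v" if "k \<in> ?S" using eq Max_ge[OF that] by simp
qed

lemma hom_class_walk_weight_le: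
  assumes "D \<in> hom_class (path_power n d)" "undirected_walk D U"
  shows "walk_weight D d U \<le> int n - 1"
proof -
  from assms(1) obtain h where h: "digraph_hom D (path_power n d) h" by (auto simp: hom_class_def)
  have "hd U \<in> pverts D" "last U \<in> pverts D"
    using assms(2) by (auto simp: undirected_walk_def)
  then have "h (last U) < int n" "0 \<le> h (hd U)"
    using h by (simp_all add: digraph_hom_path_power_iff)
  moreover have "walk_weight D d U \<le> h (last U) - h (hd U)"
    using h assms(2) potential_walk_weight by (simp add: digraph_hom_path_power_iff)
  ultimately show ?thesis by linarith
qed

lemma max_walk_weight_hom:
  assumes bound: "\<And>U. undirected_walk D U \<Longrightarrow> walk_weight D d U \<le> int n - 1"
  shows "digraph_hom D (path_power n d) (max_walk_weight D d)"
proof -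
  note greatest = max_walk_weight_greatest[OF bound]
  have "potential (max_walk_weight D d)"
    unfolding potential_def
  proof (safe)
    fix u v assume uv: "(u, v) \<in> parcs D"
    note V = arc_ends[OF uv]
    show "max_walk_weight D d u + 1 \<le> max_walk_weight D d v"
      using greatest(2)[OF _ V(2)] walk_weights_to_extend(1)[OF greatest(1)[OF _ V(1)] uv] by blast
    \<comment> \<open>Here an optimal walk to \<open>v\<close> is continued backwards along the arc,
      at the cost of \<open>d\<close>.\<close>
    have "max_walk_weight D d v - int d \<le> max_walk_weight D d u"
      using greatest(2)[OF _ V(1)] walk_weights_to_extend(2)[OF greatest(1)[OF _ V(2)] uv] by blast
    then show "max_walk_weight D d v \<le> max_walk_weight D d u + int d" by simp
  qed
  moreover have "0 \<le> max_walk_weight D d v \<and> max_walk_weight D d v < int n" if "v \<in> pverts D" for v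
  proof
    show "0 \<le> max_walk_weight D d v"
      using greatest(2)[OF _ that] zero_in_walk_weights_to[OF that] by blast
    have "max_walk_weight D d v \<in> walk_weights_to D d v" using greatest(1)[OF _ that] .
    then show "max_walk_weight D d v < int n" using bound by (force simp: walk_weights_to_def)
  qed
  ultimately show ?thesis by (simp add: digraph_hom_path_power_iff)
qed

text \<open>A repeated vertex bounds a closed subwalk. Removing it shortens the walk, keeps the last
  vertex and does not lower the weight.\<close>

lemma undirected_walk_shortcut:
  assumes h: "potential h" and U: "undirected_walk D U"
  shows "\<exists>U'. undirected_walk D U' \<and> last U' = last U \<and> distinct U' \<and>
    walk_weight D d U \<le> walk_weight D d U'"
  using U
proof (induction "length U" arbitrary: U rule: less_induct)
  case less
  show ?case
  proof (cases "distinct U")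
    case False
    then obtain xs ys zs w where U: "U = xs @ [w] @ ys @ [w] @ zs"
      using not_distinct_decomp by blast
    let ?U' = "xs @ w # zs" and ?C = "w # ys @ [w]"
    have walks: "undirected_walk D ?U'" "undirected_walk D ?C"
      using less.prems undirected_walk_append_iff[of D xs w "ys @ w # zs"]
        undirected_walk_append_iff[of D "w # ys" w zs] undirected_walk_append_iff[of D xs w zs]
      by (simp_all add: U)
    have "walk_weight D d U = walk_weight D d ?U' + walk_weight D d ?C"
      using step_sum_append[of arc_weight xs w "ys @ w # zs"] step_sum_append[of arc_weight xs w zs]
        step_sum_append[of arc_weight "w # ys" w zs] less.prems walks
      by (simp add: walk_weight_eq_step_sum U)
    \<comment> \<open>The potential takes the same value at both ends of the closed walk.\<close>
    moreover have "walk_weight D d ?C \<le> 0"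
      using potential_walk_weight[OF h walks(2)] by simp
    moreover have "length ?U' < length U" "last ?U' = last U" by (simp_all add: U)
    ultimately show ?thesis using less.hyps[OF _ walks(1)] by fastforce
  qed (use less.prems in blast)
qed

lemma undirected_walk_distinct_length:
  "undirected_walk D U \<Longrightarrow> distinct U \<Longrightarrow> length U \<le> card (pverts D)"
  by (metis card_mono distinct_card finite_verts undirected_walk_def)

end


section \<open>Correctness of the relaxation method\<close>

text \<open>The value at a vertex \<open>v\<close> is stored in the memory cell \<open>\<alpha> v\<close>.\<close>

fun relax :: "nat \<Rightarrow> ('a \<Rightarrow> nat) \<Rightarrow> 'a \<times> 'a \<Rightarrow> (nat \<Rightarrow> nat) \<Rightarrow> nat \<Rightarrow> nat" where
  "relax d \<alpha> (u, v) M =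
     (let y = max (M (\<alpha> v)) (M (\<alpha> u) + 1)
      in M(\<alpha> v := y, \<alpha> u := max (M (\<alpha> u)) (y - d)))"

text \<open>A frame condition; it later shows that the stored arcs survive the relaxation.\<close>

lemma relax_outside: "a \<notin> range \<alpha> \<Longrightarrow> relax d \<alpha> e M a = M a"
  by (cases e) (auto simp: Let_def)

lemma fold_relax_outside: "a \<notin> range \<alpha> \<Longrightarrow> fold (relax d \<alpha>) as M a = M a"
  by (induction as arbitrary: M) (simp_all add: relax_outside)

lemma relax_increasing: "M a \<le> relax d \<alpha> e M a"
  by (cases e) (auto simp: Let_def)

lemma fold_relax_increasing: "M a \<le> fold (relax d \<alpha>) as M a"
proof (induction as arbitrary: M)
  case (Cons e as)
  then show ?case using relax_increasing[of M a d \<alpha> e] le_trans by fastforce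
qed simp

text \<open>When \<open>(u, v)\<close> is relaxed, both values are at least those at the start of
  the round, and nothing decreases afterwards.\<close>

lemma fold_relax_arc:
  assumes "(u, v) \<in> set as" "\<alpha> u \<noteq> \<alpha> v"
  shows "M (\<alpha> u) + 1 \<le> fold (relax d \<alpha>) as M (\<alpha> v)"
    and "M (\<alpha> v) \<le> fold (relax d \<alpha>) as M (\<alpha> u) + d"
proof -
  obtain xs ys where as: "as = xs @ (u, v) # ys" using assms(1) split_list by fast
  let ?M = "fold (relax d \<alpha>) xs M"
  let ?M' = "relax d \<alpha> (u, v) ?M"
  note le = fold_relax_increasing[of M _ d \<alpha> xs] fold_relax_increasing[of ?M' _ d \<alpha> ys]
  have "?M (\<alpha> u) + 1 \<le> ?M' (\<alpha> v)" "?M (\<alpha> v) \<le> ?M' (\<alpha> u) + d"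
    using assms(2) by (auto simp: Let_def)
  then show "M (\<alpha> u) + 1 \<le> fold (relax d \<alpha>) as M (\<alpha> v)"
    "M (\<alpha> v) \<le> fold (relax d \<alpha>) as M (\<alpha> u) + d"
    using le[of "\<alpha> u"] le[of "\<alpha> v"] unfolding as by (auto simp del: relax.simps)
qed

section \<open>Bounds on the values after a number of rounds\<close>

context antisymmetric_pair_digraph
begin

context
  fixes \<alpha> :: "'a \<Rightarrow> nat" and as :: "('a \<times> 'a) list" and M\<^sub>0 :: "nat \<Rightarrow> nat"
  assumes inj: "inj_on \<alpha> (pverts D)" and arcs: "set as = parcs D"
    and zero: "\<And>v. v \<in> pverts D \<Longrightarrow> M\<^sub>0 (\<alpha> v) = 0"
begin

lemma fold_relax_le_potential:
  assumes h: "potential h" and "set bs \<subseteq> parcs D" "\<And>w. w \<in> pverts D \<Longrightarrow> int (M (\<alpha> w)) \<le> h w"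
    and "w \<in> pverts D"
  shows "int (fold (relax d \<alpha>) bs M (\<alpha> w)) \<le> h w"
  using assms(2-)
proof (induction bs arbitrary: M)
  case (Cons e bs)
  obtain u v where e: "e = (u, v)" by (cases e)
  with Cons.prems(1) have uv: "(u, v) \<in> parcs D" by simp
  note V = arc_ends[OF uv]
  have "int (relax d \<alpha> e M (\<alpha> x)) \<le> h x" if x: "x \<in> pverts D" for x
  proof -
    \<comment> \<open>Injectivity ensures that among the vertices only \<open>u\<close> and
      \<open>v\<close> get new values; the two inequalities for \<open>h\<close> then bound
      these.\<close>
    have "\<alpha> x = \<alpha> u \<longleftrightarrow> x = u" "\<alpha> x = \<alpha> v \<longleftrightarrow> x = v"
      using inj V x by (auto dest: inj_onD)
    moreover have "h u + 1 \<le> h v" "h v \<le> h u + int d" using h uv by (auto simp: potential_def)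
    ultimately show ?thesis
      using Cons.prems(2)[OF V(1)] Cons.prems(2)[OF V(2)] Cons.prems(2)[OF x]
      by (auto simp: e Let_def)
  qed
  then show ?case using Cons by simp
qed simp

lemma rounds_le_potential:
  assumes "potential h" "\<And>v. v \<in> pverts D \<Longrightarrow> 0 \<le> h v" "w \<in> pverts D"
  shows "int ((fold (relax d \<alpha>) as ^^ k) M\<^sub>0 (\<alpha> w)) \<le> h w"
  using assms(3)
proof (induction k arbitrary: w)
  case 0
  then show ?case using assms(2) zero by simp
next
  case (Suc k)
  then show ?case using fold_relax_le_potential[OF assms(1)] arcs by simp
qed

text \<open>\<open>length U\<close> counts vertices, so this concerns walks of at most
  \<open>k\<close> steps. The last step is split off: the latest round relaxes its arc, starting
  from a value already large enough at the previous vertex.\<close>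

lemma walk_weight_le_rounds:
  "undirected_walk D U \<Longrightarrow> length U \<le> Suc k \<Longrightarrow>
     walk_weight D d U \<le> int ((fold (relax d \<alpha>) as ^^ k) M\<^sub>0 (\<alpha> (last U)))"
proof (induction k arbitrary: U)
  case 0
  then obtain v where "U = [v]" by (cases U) (auto simp: undirected_walk_def)
  then show ?case using 0 by (simp add: walk_weight_eq_step_sum)
next
  case (Suc k)
  let ?M = "(fold (relax d \<alpha>) as ^^ k) M\<^sub>0"
  let ?M' = "fold (relax d \<alpha>) as ?M"
  have "walk_weight D d U \<le> int (?M' (\<alpha> (last U)))"
  proof (cases "length U \<le> Suc k")
    case True
    then show ?thesis
      using Suc.IH[OF Suc.prems(1)] fold_relax_increasing[of ?M "\<alpha> (last U)" d \<alpha> as] by linarith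
  next
    case False
    then obtain W v where U: "U = W @ [v]" "W \<noteq> []" "length W = Suc k"
      using Suc.prems(2) by (cases U rule: rev_cases) fastforce+
    then have W: "undirected_walk D W"
      and last: "(last W, v) \<in> parcs D \<or> (v, last W) \<in> parcs D"
      using Suc.prems(1) by (auto simp: undirected_walk_iff_successively successively_append_iff)
    have IH: "walk_weight D d W \<le> int (?M (\<alpha> (last W)))" using Suc.IH[OF W] U by simp
    have neq: "\<alpha> (last W) \<noteq> \<alpha> v" using last arc_ends inj by (metis inj_onD)
    have "arc_weight (last W) v \<le> int (?M' (\<alpha> v)) - int (?M (\<alpha> (last W)))"
      using last
    proof
      assume "(last W, v) \<in> parcs D"
      then show ?thesis
        using fold_relax_arc(1)[of "last W" v as \<alpha> ?M d] arcs neq by (simp add: arc_weight_def)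
    next
      assume "(v, last W) \<in> parcs D"
      then show ?thesis
        using fold_relax_arc(2)[of v "last W" as \<alpha> ?M d] arcs neq not_both_arcs[of v "last W"]
        by (simp add: arc_weight_def)
    qed
    then show ?thesis using IH undirected_walk_snoc(2)[OF W last] by (simp add: U)
  qed
  then show ?case by simp
qed

text \<open>The maximum weight is itself a nonnegative potential, hence an upper bound for the
  computed values; an optimal walk with distinct vertices gives the lower bound.\<close>

lemma rounds_eq_max_walk_weight:
  assumes "D \<in> hom_class (path_power n d)" and v: "v \<in> pverts D"
  shows "int ((fold (relax d \<alpha>) as ^^ card (pverts D)) M\<^sub>0 (\<alpha> v)) = max_walk_weight D d v"
proof (rule antisym)
  note bound = hom_class_walk_weight_le[OF assms(1)]
  from max_walk_weight_hom[OF bound]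
  have l: "potential (max_walk_weight D d)" "\<And>v. v \<in> pverts D \<Longrightarrow> 0 \<le> max_walk_weight D d v"
    by (auto simp: digraph_hom_path_power_iff)
  from rounds_le_potential[OF l v]
  show "int ((fold (relax d \<alpha>) as ^^ card (pverts D)) M\<^sub>0 (\<alpha> v)) \<le> max_walk_weight D d v" .
  obtain U where "undirected_walk D U" "last U = v" "walk_weight D d U = max_walk_weight D d v"
    using max_walk_weight_greatest(1)[OF bound v] by (auto simp: walk_weights_to_def)
  then obtain W where W: "undirected_walk D W" "last W = v" "distinct W"
    "max_walk_weight D d v \<le> walk_weight D d W"
    using undirected_walk_shortcut[OF l(1)] by metis
  \<comment> \<open>A distinct walk has at most |V| vertices, so |V| rounds cover all its
    steps.\<close>
  then have "length W \<le> Suc (card (pverts D))" using undirected_walk_distinct_length by fastforce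
  from walk_weight_le_rounds[OF W(1) this] W
  show "max_walk_weight D d v \<le> int ((fold (relax d \<alpha>) as ^^ card (pverts D)) M\<^sub>0 (\<alpha> v))"
    by simp
qed

end

end


section \<open>The relaxation method on the random access machine\<close>

text \<open>
  Register 0 is always 0 and register 1 is 1, so that \<open>Jump_less 0 1\<close> is an unconditional jump.
  Register 2 counts the remaining rounds, register 3 is the address of the first output cell,
  register 4 is \<open>d\<close>, and register 6 points to the next arc. A maximum is computed as
  \<open>a + (b - a)\<close> with truncated subtraction.
\<close>

definition relaxation_program :: "instr list" where
  "relaxation_program =
    [ Load 2 0, Const 1 1, Load 3 1, Const 5 2, Load 4 5, Add 3 3 3, Const 6 3, Add 3 3 6,
      \<comment> \<open>8: next round\<close>
      Jump_less 0 2 10, Jump_less 0 1 31, Sub 2 2 1, Const 6 3,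
      \<comment> \<open>12: next arc\<close>
      Jump_less 6 3 14, Jump_less 0 1 8,
      Load 7 6, Add 6 6 1, Load 8 6, Add 6 6 1, Add 7 3 7, Add 8 3 8, Load 9 7, Load 10 8,
      Add 11 9 1, Sub 11 11 10, Add 10 10 11, Store 8 10,
      Sub 11 10 4, Sub 11 11 9, Add 9 9 11, Store 7 9, Jump_less 0 1 12 ]"

section \<open>Symbolic execution of the program segments\<close>

lemma ram_step_program:
  "pc < 31 \<Longrightarrow> ram_step relaxation_program (pc, R, M) =
     exec_instr (relaxation_program ! pc) (pc, R, M)"
  by (simp add: ram_step_def relaxation_program_def)

text \<open>Unfolds the program only where an instruction is fetched, so that
  \<open>ram_step relaxation_program\<close> stays folded.\<close>

lemmas program_nth = arg_cong[OF relaxation_program_def, of "\<lambda>p. p ! pc" for pc]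

text \<open>Peels off the first step, so that the simplifier runs the machine forwards from the
  given configuration.\<close>

lemma funpow_numeral_right: "(f ^^ numeral k) x = (f ^^ pred_numeral k) (f x)"
  by (simp add: numeral_eq_Suc funpow_Suc_right del: funpow.simps)

lemma funpow_trans: "(f ^^ m) x = y \<Longrightarrow> (f ^^ n) y = z \<Longrightarrow> (f ^^ (m + n)) x = z"
  by (simp add: add.commute[of m] funpow_add)

text \<open>The state shared by both loop heads. The arc pointer in register 6 is tracked
  separately; register 5 and registers 7 to 11 are scratch.\<close>

definition program_registers :: "nat \<Rightarrow> nat \<Rightarrow> nat \<Rightarrow> (nat \<Rightarrow> nat) \<Rightarrow> bool" where
  "program_registers r b d R \<longleftrightarrow> R 0 = 0 \<and> R 1 = 1 \<and> R 2 = r \<and> R 3 = b \<and> R 4 = d"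

lemmas program_simps = ram_step_program program_nth funpow_numeral_right program_registers_def

lemma program_init:
  "\<exists>R. (ram_step relaxation_program ^^ 8) (0, \<lambda>_. 0, M) = (8, R, M) \<and>
     program_registers (M 0) (3 + 2 * M 1) (M 2) R"
  by (simp add: program_simps)

lemma program_round_begin:
  assumes "program_registers (Suc r) b d R"
  shows "\<exists>R'. (ram_step relaxation_program ^^ 3) (8, R, M) = (12, R', M) \<and>
    program_registers r b d R' \<and> R' 6 = 3"
  using assms by (simp add: program_simps)

lemma program_arc:
  assumes "program_registers r b d R" "R 6 < b"
    and "M (R 6) = \<phi> u" "M (R 6 + 1) = \<phi> v" "\<phi> u \<noteq> \<phi> v"
  shows "\<exists>R'. (ram_step relaxation_program ^^ 18) (12, R, M) =
      (12, R', relax d (\<lambda>w. b + \<phi> w) (u, v) M) \<and>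
    program_registers r b d R' \<and> R' 6 = R 6 + 2"
proof -
  \<comment> \<open>The second identity has the shape that nested truncated subtractions take after
    simplification: \<open>y - z - x\<close> becomes \<open>y - (z + x)\<close>.\<close>
  have max: "x + (y - x) = max x y" "x + (y - (z + x)) = max x (y - z)" for x y z :: nat by auto
  show ?thesis using assms by (simp add: program_simps max Let_def)
qed

lemma program_round_end:
  assumes "program_registers r b d R" "R 6 = b"
  shows "(ram_step relaxation_program ^^ 2) (12, R, M) = (8, R, M)"
  using assms by (simp add: program_simps)

lemma program_exit:
  assumes "program_registers 0 b d R"
  shows "(ram_step relaxation_program ^^ 2) (8, R, M) = (31, R, M)"
  using assms by (simp add: program_simps)

section \<open>The loops over arcs and rounds\<close>

definition stores_arcs :: "('a \<Rightarrow> nat) \<Rightarrow> ('a \<times> 'a) list \<Rightarrow> (nat \<Rightarrow> nat) \<Rightarrow> bool" where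
  "stores_arcs \<phi> as M \<longleftrightarrow>
     (\<forall>i < length as. M (3 + 2 * i) = \<phi> (fst (as ! i)) \<and> M (3 + 2 * i + 1) = \<phi> (snd (as ! i)))"

context
  fixes \<phi> :: "'a \<Rightarrow> nat" and as :: "('a \<times> 'a) list" and b d :: nat
  assumes b: "b = 3 + 2 * length as" and ends: "\<And>u v. (u, v) \<in> set as \<Longrightarrow> \<phi> u \<noteq> \<phi> v"
begin

abbreviation relax_arcs :: "('a \<times> 'a) list \<Rightarrow> (nat \<Rightarrow> nat) \<Rightarrow> nat \<Rightarrow> nat" where
  "relax_arcs \<equiv> fold (relax d (\<lambda>w. b + \<phi> w))"

text \<open>All values live in cells from \<open>b\<close> on, and the arcs are stored below
  \<open>b\<close>.\<close>

lemma stores_arcs_relax: "stores_arcs \<phi> as M \<Longrightarrow> stores_arcs \<phi> as (relax_arcs bs M)"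
proof -
  have "a \<notin> range (\<lambda>w. b + \<phi> w)" if "a < b" for a using that by auto
  then have "relax_arcs bs M a = M a" if "a < b" for a using that fold_relax_outside by metis
  then show "stores_arcs \<phi> as (relax_arcs bs M)" if "stores_arcs \<phi> as M"
    using that by (simp add: stores_arcs_def b)
qed

lemma program_arcs:
  assumes "program_registers r b d R" "R 6 = 3" "stores_arcs \<phi> as M"
  shows "j \<le> length as \<Longrightarrow>
    \<exists>R'. (ram_step relaxation_program ^^ (18 * j)) (12, R, M) = (12, R', relax_arcs (take j as) M) \<and>
      program_registers r b d R' \<and> R' 6 = 3 + 2 * j"
proof (induction j)
  case (Suc j)
  then obtain R' where
    run: "(ram_step relaxation_program ^^ (18 * j)) (12, R, M) = (12, R', relax_arcs (take j as) M)"
    and R': "program_registers r b d R'" "R' 6 = 3 + 2 * j" by auto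
  have j: "j < length as" using Suc.prems by simp
  obtain u v where uv: "as ! j = (u, v)" by (cases "as ! j")
  have neq: "\<phi> u \<noteq> \<phi> v" using ends uv j nth_mem by metis
  have "stores_arcs \<phi> as (relax_arcs (take j as) M)"
    using assms(3) by (rule stores_arcs_relax)
  then have mem: "relax_arcs (take j as) M (R' 6) = \<phi> u" "relax_arcs (take j as) M (R' 6 + 1) = \<phi> v"
    using j uv R' by (auto simp: stores_arcs_def)
  have lt: "R' 6 < b" using R' j b by simp
  obtain R'' where
    "(ram_step relaxation_program ^^ 18) (12, R', relax_arcs (take j as) M) =
       (12, R'', relax d (\<lambda>w. b + \<phi> w) (u, v) (relax_arcs (take j as) M))"
    "program_registers r b d R''" "R'' 6 = R' 6 + 2"
    using program_arc[where \<phi> = \<phi>, OF R'(1) lt mem neq] by blast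
  then show ?case
    using funpow_trans[OF run] R' j uv
    by (intro exI[of _ R'']) (simp add: take_Suc_conv_app_nth add.commute[of 18] del: relax.simps)
qed (use assms in simp)

lemma program_round:
  assumes "program_registers (Suc r) b d R" "stores_arcs \<phi> as M"
  shows "\<exists>R'. (ram_step relaxation_program ^^ (5 + 18 * length as)) (8, R, M) =
      (8, R', relax_arcs as M) \<and> program_registers r b d R'"
proof -
  obtain R1 where R1: "(ram_step relaxation_program ^^ 3) (8, R, M) = (12, R1, M)"
    "program_registers r b d R1" "R1 6 = 3"
    using program_round_begin[OF assms(1)] by blast
  obtain R2 where R2:
    "(ram_step relaxation_program ^^ (18 * length as)) (12, R1, M) = (12, R2, relax_arcs as M)"
    "program_registers r b d R2" "R2 6 = 3 + 2 * length as"
    using program_arcs[OF R1(2,3) assms(2), of "length as"] by auto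
  have "(ram_step relaxation_program ^^ (3 + 18 * length as + 2)) (8, R, M) = (8, R2, relax_arcs as M)"
    using funpow_trans[OF funpow_trans[OF R1(1) R2(1)] program_round_end[OF R2(2)]] R2(3) b by simp
  \<comment> \<open>Three steps enter the round, 18 handle each arc, and two return to the loop
    head.\<close>
  moreover have "3 + 18 * length as + 2 = 5 + 18 * length as" by simp
  ultimately show ?thesis using R2(2) by metis
qed

lemma program_rounds:
  assumes "program_registers k b d R" "stores_arcs \<phi> as M"
  shows "\<exists>R'. (ram_step relaxation_program ^^ (k * (5 + 18 * length as))) (8, R, M) =
      (8, R', (relax_arcs as ^^ k) M) \<and> program_registers 0 b d R'"
  using assms
proof (induction k arbitrary: R M)
  case (Suc k)
  obtain R1 where R1: "(ram_step relaxation_program ^^ (5 + 18 * length as)) (8, R, M) =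
      (8, R1, relax_arcs as M)" "program_registers k b d R1"
    using program_round[OF Suc.prems] by blast
  obtain R2 where R2: "(ram_step relaxation_program ^^ (k * (5 + 18 * length as)))
      (8, R1, relax_arcs as M) = (8, R2, (relax_arcs as ^^ k) (relax_arcs as M))"
    "program_registers 0 b d R2"
    using Suc.IH[OF R1(2) stores_arcs_relax[OF Suc.prems(2)]] by blast
  show ?case
    using funpow_trans[OF R1(1) R2(1)] R2(2) by (simp add: funpow_swap1)
qed simp

lemma program_halts:
  assumes "stores_arcs \<phi> as M" "M 0 = k" "M 1 = length as" "M 2 = d"
    and t: "8 + k * (5 + 18 * length as) + 2 \<le> t"
  shows "ram_halts_within relaxation_program M t ((relax_arcs as ^^ k) M)"
proof -
  let ?p = "relaxation_program" and ?r = "k * (5 + 18 * length as)"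
  obtain R1 where R1: "(ram_step ?p ^^ 8) (0, \<lambda>_. 0, M) = (8, R1, M)" "program_registers k b d R1"
    using program_init[of M] assms(2-4) b by auto
  obtain R2 where R2: "(ram_step ?p ^^ ?r) (8, R1, M) = (8, R2, (relax_arcs as ^^ k) M)"
    "program_registers 0 b d R2"
    using program_rounds[OF R1(2) assms(1)] by blast
  \<comment> \<open>A halted configuration is a fixed point, so the surplus steps up to
    \<open>t\<close> change nothing.\<close>
  have halted: "(ram_step ?p ^^ s) (31, R2, N) = (31, R2, N)" for s N
    by (induction s) (simp_all add: ram_step_def relaxation_program_def)
  obtain s where "t = 8 + ?r + 2 + s" using t by (auto simp: le_iff_add)
  then have "(ram_step ?p ^^ t) (0, \<lambda>_. 0, M) = (31, R2, (relax_arcs as ^^ k) M)"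
    using funpow_trans[OF funpow_trans[OF funpow_trans[OF R1(1) R2(1)] program_exit[OF R2(2)]] halted]
    by simp
  then show ?thesis by (auto simp: ram_halts_within_def relaxation_program_def)
qed

end

section \<open>Input encoding and running time\<close>

lemma length_ram_input: "length (ram_input \<phi> as D d) = 3 + 2 * length as"
  by (induction as) (auto simp: ram_input_def)

lemma ram_input_arcs: "stores_arcs \<phi> as (memory_of (ram_input \<phi> as D d))"
proof -
  have "concat (map (\<lambda>(u, v). [\<phi> u, \<phi> v]) as) ! (2 * i) = \<phi> (fst (as ! i)) \<and>
      concat (map (\<lambda>(u, v). [\<phi> u, \<phi> v]) as) ! (2 * i + 1) = \<phi> (snd (as ! i))"
    if "i < length as" for i
    using that
  proof (induction as arbitrary: i)
    case (Cons e as)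
    then show ?case by (cases i) (auto split: prod.splits)
  qed simp
  then show ?thesis
    by (simp add: stores_arcs_def memory_of_def length_ram_input) (simp add: ram_input_def nth_append)
qed

lemma (in antisymmetric_pair_digraph) relaxation_program_computes:
  assumes hom: "D \<in> hom_class (path_power n d)"
  shows "ram_computes_within relaxation_program D d (max_walk_weight D d)
    (33 * (max 1 (card (pverts D)) * max 1 (card (parcs D))))"
  unfolding ram_computes_within_def
proof (intro allI impI)
  fix \<phi> :: "'a \<Rightarrow> nat" and as
  assume pres: "presents \<phi> as D"
  then have inj: "inj_on \<phi> (pverts D)" and as: "set as = parcs D" "distinct as"
    by (auto simp: presents_def bij_betw_def)
  from as have len: "length as = card (parcs D)" by (metis distinct_card)
  let ?in = "ram_input \<phi> as D d"
  let ?M = "memory_of ?in" and ?b = "3 + 2 * length as" and ?k = "card (pverts D)"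
  let ?x = "max 1 ?k" and ?y = "max 1 (length as)"
  \<comment> \<open>The overhead 8 + 2, the 5 steps per round and the 18 steps per arc and round are
    each bounded by a multiple of the product, and 10 + 5 + 18 = 33.\<close>
  have "?k * 5 \<le> 5 * (?x * ?y)" "?k * length as \<le> ?x * ?y" "1 * 1 \<le> ?x * ?y"
    using mult_le_mono[of ?k ?x 1 ?y] mult_le_mono[of ?k ?x "length as" ?y]
      mult_le_mono[of 1 ?x 1 ?y] by auto
  then have "8 + ?k * (5 + 18 * length as) + 2 \<le> 33 * (?x * ?y)"
    by (simp add: algebra_simps)
  moreover have "\<phi> u \<noteq> \<phi> v" if "(u, v) \<in> set as" for u v
    using that as arc_ends inj by (metis inj_onD)
  ultimately have "ram_halts_within relaxation_program ?M (33 * (?x * ?y))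
      ((fold (relax d (\<lambda>w. ?b + \<phi> w)) as ^^ ?k) ?M)"
    by (intro program_halts ram_input_arcs) (auto simp: memory_of_def ram_input_def len)
  \<comment> \<open>Cells behind the input hold 0, which provides the zero start values; shifting
    the numbering by \<open>?b\<close> keeps it injective.\<close>
  moreover have "int ((fold (relax d (\<lambda>w. ?b + \<phi> w)) as ^^ ?k) ?M (length ?in + \<phi> v)) =
      max_walk_weight D d v" if v: "v \<in> pverts D" for v
    using rounds_eq_max_walk_weight[of "\<lambda>w. ?b + \<phi> w" as ?M, OF _ as(1) _ hom v] inj
    by (simp add: length_ram_input memory_of_def inj_on_def)
  ultimately show "\<exists>M'. ram_halts_within relaxation_program ?M
      (33 * (max 1 (card (pverts D)) * max 1 (card (parcs D)))) M' \<and>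
      (\<forall>v \<in> pverts D. int (M' (length ?in + \<phi> v)) = max_walk_weight D d v)"
    unfolding len by blast
qed

text \<open>Program and constant are chosen before \<open>n\<close>, \<open>d\<close> and
  \<open>D\<close>, so they are uniform. The factors \<open>max 1\<close> account for the time spent
  even when there are no vertices or no arcs.\<close>

theorem theorem3p1:
  shows
    "(\<forall>(n::nat) (d::nat) (D::'a pair_pre_digraph).
        pair_fin_digraph D \<and> antisymmetric_digraph D \<longrightarrow>
          (D \<in> hom_class (path_power n d) \<longleftrightarrow>
             (\<forall>U. undirected_walk D U \<longrightarrow> walk_weight D d U \<le> int n - 1)) \<and>
          (D \<in> hom_class (path_power n d) \<longrightarrow>
             (\<forall>v \<in> pverts D.
                max_walk_weight D d v \<in> walk_weights_to D d v \<and>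
                (\<forall>k \<in> walk_weights_to D d v. k \<le> max_walk_weight D d v)) \<and>
             digraph_hom D (path_power n d) (max_walk_weight D d)))
     \<and>
     (\<exists>(p::instr list) (C::nat). \<forall>(n::nat) (d::nat) (D::'a pair_pre_digraph).
        pair_fin_digraph D \<and> antisymmetric_digraph D \<and> D \<in> hom_class (path_power n d) \<longrightarrow>
          ram_computes_within p D d (max_walk_weight D d)
            (C * (max 1 (card (pverts D)) * max 1 (card (parcs D)))))"
proof (intro conjI exI[of _ relaxation_program] exI[of _ 33] allI impI, goal_cases)
  case (1 n d D)
  then interpret antisymmetric_pair_digraph D d
    by (simp add: antisymmetric_pair_digraph_def antisymmetric_pair_digraph_axioms_def)
  show ?case
    using hom_class_walk_weight_le max_walk_weight_hom unfolding hom_class_def by blast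
next
  case (2 n d D)
  then interpret antisymmetric_pair_digraph D d
    by (simp add: antisymmetric_pair_digraph_def antisymmetric_pair_digraph_axioms_def)
  show ?case
    using 2 hom_class_walk_weight_le max_walk_weight_greatest by blast
next
  case (3 n d D)
  then interpret antisymmetric_pair_digraph D d
    by (simp add: antisymmetric_pair_digraph_def antisymmetric_pair_digraph_axioms_def)
  show ?case using 3 hom_class_walk_weight_le max_walk_weight_hom by blast
next
  case (4 n d D)
  then interpret antisymmetric_pair_digraph D d
    by (simp add: antisymmetric_pair_digraph_def antisymmetric_pair_digraph_axioms_def)
  show ?case using 4 relaxation_program_computes by blast
qed

end
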